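(* The base-cobase graph $G(R_{10},R_{10}^\ast)$ is isomorphic to the graph with vertex set $(S_5/D_5)\cup(S_5/S_2)$ (disjoint union) in which: (1) the neighbors of $[abcde]_{S_2}$ are $[abcde]_{D_5}$, $[cbade]_{S_2}$, $[acbde]_{S_2}$, $[abdce]_{S_2}$, $[abedc]_{S_2}$; (2) the neighbors of $[abcde]_{D_5}$ are $[abcde]_{S_2}$, $[bcdea]_{S_2}$, $[cdeab]_{S_2}$, $[deabc]_{S_2}$, $[eabcd]_{S_2}$.
   Context: $R_{10}$ is the matroid with ground set $\binom{[5]}{3}$ in which a collection of triples is independent iff their incidence vectors in $\mathbb{F}_2^5$ are linearly independent over $\mathbb{F}_2$. A base-cobase is a base whose complement is also a base; $G(R_{10},R_{10}^\ast)$ has the base-cobases as vertices, adjacent iff their symmetric difference has exactly two elements. Permutations of $\{1,2,3,4,5\}$ are written as words $abcde$. $S_5/S_2$ is the set of classes $[abcde]_{S_2}$ of words under the identification $abcde\sim edcba$ (reversal); $S_5/D_5$ is the set of classes $[abcde]_{D_5}$ under the equivalence generated by reversal $abcde\sim edcba$ and cyclic shift $abcde\sim bcdea$. *)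

theory Defs
  imports
    "HOL-Analysis.Cartesian_Space"
    "HOL-Library.Z2"
    "HOL-Library.Numeral_Type"
    "HOL-Combinatorics.Multiset_Permutations"
    "Graph_Theory.Pair_Digraph"
    "Graph_Theory.Digraph_Isomorphism"
begin

record 'a matroid_data =
  ground :: "'a set"
  indep :: "'a set \<Rightarrow> bool"

locale matroid =
  fixes M :: "'a matroid_data"
  assumes finite_ground: "finite (ground M)"
    and indep_subset_ground: "indep M A \<Longrightarrow> A \<subseteq> ground M"
    and indep_empty: "indep M {}"
    and indep_subset: "indep M B \<Longrightarrow> A \<subseteq> B \<Longrightarrow> indep M A"
    and augment: "indep M A \<Longrightarrow> indep M B \<Longrightarrow> card A < card B \<Longrightarrow>
      \<exists>x \<in> B - A. indep M (insert x A)"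

definition base :: "'a matroid_data \<Rightarrow> 'a set \<Rightarrow> bool" where
  "base M B \<longleftrightarrow> indep M B \<and> (\<forall>A. indep M A \<and> B \<subseteq> A \<longrightarrow> A = B)"

definition base_cobase :: "'a matroid_data \<Rightarrow> 'a set \<Rightarrow> bool" where
  "base_cobase M B \<longleftrightarrow> base M B \<and> base M (ground M - B)"

text \<open>
  Simple graphs are symmetric loop-free digraphs: an edge is a pair of opposite arcs.
\<close>

definition base_cobase_graph :: "'a matroid_data \<Rightarrow> 'a set pair_pre_digraph" where
  "base_cobase_graph M = \<lparr>
     pverts = {B. base_cobase M B},
     parcs = {(A, B). base_cobase M A \<and> base_cobase M B \<and> card (sym_diff A B) = 2} \<rparr>"

text \<open>
  The set $[5]$ is the type \<open>5\<close>; its elements are \<open>1, 2, 3, 4, 5\<close>, where \<open>5 = 0\<close>.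
  The field $F_2$ is the type \<open>bit\<close>.
\<close>

definition incidence_vector :: "5 set \<Rightarrow> bit ^ 5" where
  "incidence_vector T = (\<chi> i. of_bool (i \<in> T))"

lemma inj_incidence_vector: "inj incidence_vector"
  by (auto simp: inj_def incidence_vector_def vec_eq_iff)

text \<open>
  Independence of the image set is independence of the family of incidence vectors,
  because \<open>incidence_vector\<close> is injective.
\<close>

definition R10 :: "5 set matroid_data" where
  "R10 = \<lparr>
     ground = {T. card T = 3},
     indep = (\<lambda>A. A \<subseteq> {T. card T = 3} \<and> vec.independent (incidence_vector ` A)) \<rparr>"

lemma matroid_R10: "matroid R10"
proof
  fix A B :: "5 set set"
  assume A: "indep R10 A" and B: "indep R10 B" and less: "card A < card B"
  have card_image: "card (incidence_vector ` X) = card X" for X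
    by (rule card_image) (rule inj_on_subset[OF inj_incidence_vector subset_UNIV])
  have "\<not> incidence_vector ` B \<subseteq> vec.span (incidence_vector ` A)"
    using vec.independent_span_bound[of "incidence_vector ` A" "incidence_vector ` B"] B less
    by (auto simp: R10_def card_image)
  then obtain x where x: "x \<in> B" "incidence_vector x \<notin> vec.span (incidence_vector ` A)"
    by auto
  moreover from x(2) have "x \<notin> A"
    by (auto intro: vec.span_base)
  ultimately show "\<exists>x \<in> B - A. indep R10 (insert x A)"
    using A B by (intro bexI[of _ x]) (auto simp: R10_def vec.independent_insert)
next
  fix A B :: "5 set set"
  assume "indep R10 B" "A \<subseteq> B"
  then show "indep R10 A"
    using vec.independent_mono[OF _ image_mono, of incidence_vector B A]
    by (auto simp: R10_def)
qed (auto simp: R10_def vec.independent_empty)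

lemma pair_graph_base_cobase_graph:
  assumes "matroid M"
  shows "pair_graph (base_cobase_graph M)"
proof -
  interpret matroid M by fact
  let ?V = "{B. base_cobase M B}"
  have fin: "finite ?V"
    by (rule finite_subset[of _ "Pow (ground M)"])
      (auto simp: base_cobase_def base_def finite_ground dest: indep_subset_ground)
  show ?thesis
  proof
    show "finite (parcs (base_cobase_graph M))"
      by (rule finite_subset[of _ "?V \<times> ?V"]) (auto simp: fin base_cobase_graph_def)
    show "symmetric (with_proj (base_cobase_graph M))"
      by (auto simp: symmetric_def sym_def base_cobase_graph_def Un_commute)
  qed (auto simp: base_cobase_graph_def fin)
qed

abbreviation S5 :: "5 list set" where
  "S5 \<equiv> permutations_of_set UNIV"

definition S2_rel :: "5 list rel" where
  "S2_rel = {(v, w) \<in> S5 \<times> S5. equivclp (\<lambda>x y. y = rev x) v w}"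

definition D5_rel :: "5 list rel" where
  "D5_rel = {(v, w) \<in> S5 \<times> S5. equivclp (\<lambda>x y. y = rev x \<or> y = rotate1 x) v w}"

lemma equiv_S2_rel: "equiv S5 S2_rel"
  by (rule equivI) (auto simp: S2_rel_def refl_on_def sym_def trans_def
    intro: equivclp_sym equivclp_trans)

lemma equiv_D5_rel: "equiv S5 D5_rel"
  by (rule equivI) (auto simp: D5_rel_def refl_on_def sym_def trans_def
    intro: equivclp_sym equivclp_trans)

text \<open>
  The vertices of the disjoint union $(S_5/D_5) \cup (S_5/S_2)$.
\<close>

definition D5_class :: "5 list \<Rightarrow> 5 list set + 5 list set" where
  "D5_class w = Inl (D5_rel `` {w})"

definition S2_class :: "5 list \<Rightarrow> 5 list set + 5 list set" where
  "S2_class w = Inr (S2_rel `` {w})"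

definition neighbors :: "'a pair_pre_digraph \<Rightarrow> 'a \<Rightarrow> 'a set" where
  "neighbors G v = {w. (v, w) \<in> parcs G}"

end

theory Submission
  imports Defs
begin

text \<open>
  Identify a triple in $[5]$ with the edge of $K_5$ on the two remaining points. Over $F_2$ the
  edges of a 4-cycle give dependent triples, so a base-cobase is a 2-colouring of $K_5$ (edges in
  the base, edges outside it) without a monochromatic 4-cycle. If some vertex has three
  incident edges of one colour, this forces both colour classes to be bulls (a triangle with pendant
  edges at two of its vertices); otherwise both are 5-cycles. The 5-cycle $abcdea$ is named by
  $[abcde]_{D_5}$, and the bull consisting of the path $abcde$ and the chord $bd$ by
  $[abcde]_{S_2}$. Of the 25 ways to exchange an edge of such a graph for a non-edge, all but the
  five listed in the theorem create a 4-cycle in the graph or in its complement.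
\<close>

section \<open>Triples as edges of K_5; pentagons and bulls\<close>

definition opp :: "5 \<Rightarrow> 5 \<Rightarrow> 5 set" where
  "opp x y = - {x, y}"

text \<open>Complementation is injective, so comparing triples means comparing unordered pairs.
  Without distinctness assumptions this rewrites every equation between edges into equations between
  points.\<close>

lemma opp_eq_iff: "opp x y = opp z w \<longleftrightarrow> x = z \<and> y = w \<or> x = w \<and> y = z"
  by (simp add: opp_def doubleton_eq_iff)

lemma opp_commute: "opp x y = opp y x"
  by (auto simp: opp_def)

lemma card_opp: "x \<noteq> y \<Longrightarrow> card (opp x y) = 3"
  by (simp add: opp_def Compl_eq_Diff_UNIV card_Diff_subset)

lemma card_3_imp_opp:
  assumes "card T = 3"
  obtains x y where "x \<noteq> y" "T = opp x y"
proof -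
  have "card (- T) = 2"
    using assms by (simp add: Compl_eq_Diff_UNIV card_Diff_subset)
  then show ?thesis
    using that by (auto simp: card_2_iff opp_def)
qed

text \<open>The default \<open>{}\<close> on words of other lengths makes invariance under
  \<open>rev\<close> and \<open>rotate1\<close> hold for all lists. This generality is wanted
  because the closures in \<open>D5_rel\<close> and \<open>S2_rel\<close> run through arbitrary
  lists and only their end points are confined to \<open>S5\<close>.\<close>

fun cycle :: "5 list \<Rightarrow> 5 set set" where
  "cycle [a, b, c, d, e] = {opp a b, opp b c, opp c d, opp d e, opp e a}"
| "cycle _ = {}"

fun bull :: "5 list \<Rightarrow> 5 set set" where
  "bull [a, b, c, d, e] = {opp a b, opp b c, opp c d, opp d e, opp b d}"
| "bull _ = {}"

lemma UNIV_5_eq: "distinct [a, b, c, d, e :: 5] \<Longrightarrow> UNIV = {a, b, c, d, e}"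
  using card_subset_eq[of "UNIV :: 5 set" "{a, b, c, d, e}"] by simp

lemma S5_iff: "[a, b, c, d, e] \<in> S5 \<longleftrightarrow> distinct [a, b, c, d, e]"
  using UNIV_5_eq[of a b c d e] by (auto simp: permutations_of_set_def)

lemma S5_cases:
  assumes "w \<in> S5"
  obtains a b c d e where "w = [a, b, c, d, e]" "distinct [a, b, c, d, e]"
proof -
  have "length w = 5" "distinct w"
    using assms by (auto simp: permutations_of_set_def dest: distinct_card)
  then show ?thesis
    using that by (auto simp: numeral_eq_Suc length_Suc_conv simp del: distinct.simps)
qed

text \<open>The five sides and five diagonals of a pentagon exhaust the ten pairs. With the ground
  set spelled out in the letters of a given word, complements can be computed by rewriting.\<close>

lemma ground_eq:
  assumes "distinct [a, b, c, d, e]"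
  shows "{T. card T = 3} =
    {opp a b, opp b c, opp c d, opp d e, opp e a, opp a c, opp b d, opp c e, opp d a, opp e b}"
    (is "?L = ?R")
proof
  show "?R \<subseteq> ?L"
    using assms by (auto simp: card_opp)
  have opp: "opp x y \<in> ?R" if "x \<noteq> y" for x y
  proof -
    have "x \<in> {a, b, c, d, e}" "y \<in> {a, b, c, d, e}"
      using UNIV_5_eq[OF assms] by auto
    then show ?thesis
      using that by (auto simp: opp_eq_iff)
  qed
  show "?L \<subseteq> ?R"
  proof
    fix T
    assume "T \<in> ?L"
    then obtain x y where "x \<noteq> y" "T = opp x y"
      by (blast elim: card_3_imp_opp)
    from opp[OF this(1)] this(2) show "T \<in> ?R"
      by (simp only:)
  qed
qed

section \<open>Linear independence over F_2 and 4-cycles\<close>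

lemma incidence_vector_component: "incidence_vector T $ i = of_bool (i \<in> T)"
  by (simp add: incidence_vector_def)

text \<open>Injectivity of \<open>incidence_vector\<close> lets a dependence on the image be summed
  over the triples, and distinctness splits that sum into five terms. Reading it coordinate by
  coordinate leaves scalar equations over \<open>bit\<close>.\<close>

lemma independent_5:
  assumes "distinct [A, B, C, D, E :: 5 set]"
    and "\<And>p q r s t :: bit. (\<And>i. p * of_bool (i \<in> A) + q * of_bool (i \<in> B) + r * of_bool (i \<in> C) +
      s * of_bool (i \<in> D) + t * of_bool (i \<in> E) = 0) \<Longrightarrow> p = 0 \<and> q = 0 \<and> r = 0 \<and> s = 0 \<and> t = 0"
  shows "vec.independent (incidence_vector ` {A, B, C, D, E})"
proof -
  have inj: "inj_on incidence_vector X" for X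
    by (rule inj_on_subset[OF inj_incidence_vector subset_UNIV])
  show ?thesis
  proof
    assume "vec.dependent (incidence_vector ` {A, B, C, D, E})"
    then obtain u where u: "\<exists>T\<in>{A, B, C, D, E}. u (incidence_vector T) \<noteq> 0"
      "(\<Sum>T\<in>{A, B, C, D, E}. u (incidence_vector T) *s incidence_vector T) = 0"
      by (auto simp only: vec.dependent_finite finite finite_imageI finite.intros sum.reindex[OF inj] o_def ball_simps)
    have sum: "u (incidence_vector A) *s incidence_vector A + u (incidence_vector B) *s incidence_vector B +
      u (incidence_vector C) *s incidence_vector C + u (incidence_vector D) *s incidence_vector D +
      u (incidence_vector E) *s incidence_vector E = 0"
      using u(2) assms(1) by (simp add: add.assoc)
    have "u (incidence_vector A) * of_bool (i \<in> A) + u (incidence_vector B) * of_bool (i \<in> B) +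
      u (incidence_vector C) * of_bool (i \<in> C) + u (incidence_vector D) * of_bool (i \<in> D) +
      u (incidence_vector E) * of_bool (i \<in> E) = 0" for i
      using arg_cong[OF sum, of "\<lambda>v. v $ i"]
      by (simp only: vector_add_component vector_smult_component zero_index incidence_vector_component)
    from assms(2)[OF this] u(1) show False
      by auto
  qed
qed

text \<open>Coordinate \<open>i\<close> of a combination counts, mod 2, the chosen edges avoiding
  \<open>i\<close>. If all coordinates vanish, every degree has the parity of the number of chosen
  edges; since five degrees have an even sum, all degrees and that number are even. The only
  nonempty subgraph of a pentagon with even degrees is the pentagon itself, which has five edges.
  The proof checks this on all 32 coefficient vectors.\<close>

lemma independent_cycle:
  assumes "distinct [a, b, c, d, e]"
  shows "vec.independent (incidence_vector ` cycle [a, b, c, d, e])"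
  unfolding cycle.simps
proof (rule independent_5)
  show "distinct [opp a b, opp b c, opp c d, opp d e, opp e a]"
    using assms by (auto simp: opp_eq_iff)
next
  fix p q r s t :: bit
  assume *: "\<And>i. p * of_bool (i \<in> opp a b) + q * of_bool (i \<in> opp b c) + r * of_bool (i \<in> opp c d) +
      s * of_bool (i \<in> opp d e) + t * of_bool (i \<in> opp e a) = 0"
  show "p = 0 \<and> q = 0 \<and> r = 0 \<and> s = 0 \<and> t = 0"
    using *[of a] *[of b] *[of c] *[of d] *[of e] assms
    by (cases p; cases q; cases r; cases s; cases t) (auto simp: opp_def)
qed

text \<open>The same parity argument applies: the only nonempty subgraph of a bull with even degrees
  is its triangle, and three is odd.\<close>

lemma independent_bull:
  assumes "distinct [a, b, c, d, e]"
  shows "vec.independent (incidence_vector ` bull [a, b, c, d, e])"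
  unfolding bull.simps
proof (rule independent_5)
  show "distinct [opp a b, opp b c, opp c d, opp d e, opp b d]"
    using assms by (auto simp: opp_eq_iff)
next
  fix p q r s t :: bit
  assume *: "\<And>i. p * of_bool (i \<in> opp a b) + q * of_bool (i \<in> opp b c) + r * of_bool (i \<in> opp c d) +
      s * of_bool (i \<in> opp d e) + t * of_bool (i \<in> opp b d) = 0"
  show "p = 0 \<and> q = 0 \<and> r = 0 \<and> s = 0 \<and> t = 0"
    using *[of a] *[of b] *[of c] *[of d] *[of e] assms
    by (cases p; cases q; cases r; cases s; cases t) (auto simp: opp_def)
qed

text \<open>The space has dimension 5, so an independent family of five vectors is maximal.\<close>

lemma base_R10I:
  assumes "B \<subseteq> {T. card T = 3}" "vec.independent (incidence_vector ` B)" "card B = 5"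
  shows "base R10 B"
proof -
  have "A = B" if A: "vec.independent (incidence_vector ` A)" "B \<subseteq> A" for A
  proof -
    have "card (incidence_vector ` A) \<le> 5"
      using vec.dim_subset_UNIV[of "incidence_vector ` A"] A(1)
      by (simp add: vec.dim_eq_card_independent vec.dimension_def card_cart_basis)
    moreover have "card (incidence_vector ` A) = card A"
      by (rule card_image) (rule inj_on_subset[OF inj_incidence_vector subset_UNIV])
    ultimately show ?thesis
      using card_seteq[of A B] A(2) assms(3) by simp
  qed
  then show ?thesis
    using assms by (auto simp: base_def R10_def)
qed

text \<open>Each point of a 4-cycle avoids two of its edges and the fifth point avoids all four, so
  the four vectors sum to zero.\<close>

lemma indep_R10_no_4_cycle:
  assumes "indep R10 B" "distinct [x, y, z, w]"
  shows "\<not> {opp x y, opp y z, opp z w, opp w x} \<subseteq> B"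
proof
  assume sub: "{opp x y, opp y z, opp z w, opp w x} \<subseteq> B"
  let ?X = "incidence_vector ` {opp x y, opp y z, opp z w, opp w x}"
  have "incidence_vector (opp x y) =
    incidence_vector (opp y z) + incidence_vector (opp z w) + incidence_vector (opp w x)"
    using assms(2) by (auto simp: vec_eq_iff incidence_vector_def opp_def)
  \<comment> \<open>By injectivity, deleting the first vector from \<open>?X\<close> leaves the
    other three in place.\<close>
  moreover have "incidence_vector T \<in> vec.span (?X - {incidence_vector (opp x y)})"
    if "T \<in> {opp y z, opp z w, opp w x}" for T
    using that assms(2) by (intro vec.span_base) (auto simp: inj_eq[OF inj_incidence_vector] opp_eq_iff)
  ultimately have "incidence_vector (opp x y) \<in> vec.span (?X - {incidence_vector (opp x y)})"
    by (auto intro!: vec.span_add)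
  then have "vec.dependent ?X"
    unfolding vec.dependent_def by blast
  moreover have "vec.independent ?X"
    using assms(1) by (intro vec.independent_mono[OF _ image_mono[OF sub]]) (simp add: R10_def)
  ultimately show False
    by contradiction
qed

section \<open>Pentagons and bulls are base-cobases\<close>

lemma compl_cycle:
  assumes "distinct [a, b, c, d, e]"
  shows "{T. card T = 3} - cycle [a, b, c, d, e] = cycle [a, c, e, b, d]"
  unfolding ground_eq[OF assms] using assms by (simp add: opp_eq_iff insert_Diff_if eq_commute insert_commute)

text \<open>The bull is self-complementary: the five missing edges form the path
  \<open>d a c e b\<close> with chord \<open>a e\<close>.\<close>

lemma compl_bull:
  assumes "distinct [a, b, c, d, e]"
  shows "{T. card T = 3} - bull [a, b, c, d, e] = bull [d, a, c, e, b]"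
  unfolding ground_eq[OF assms] using assms
  by (simp add: opp_eq_iff insert_Diff_if eq_commute insert_commute opp_commute)

lemma card_cycle: "w \<in> S5 \<Longrightarrow> card (cycle w) = 5"
  by (erule S5_cases) (auto simp: card_insert_if opp_eq_iff)

lemma card_bull: "w \<in> S5 \<Longrightarrow> card (bull w) = 5"
  by (erule S5_cases) (auto simp: card_insert_if opp_eq_iff)

lemma base_cycle:
  assumes "distinct [a, b, c, d, e]"
  shows "base R10 (cycle [a, b, c, d, e])"
proof (rule base_R10I[OF _ independent_cycle[OF assms]])
  show "cycle [a, b, c, d, e] \<subseteq> {T. card T = 3}"
    using assms by (auto simp: card_opp)
  show "card (cycle [a, b, c, d, e]) = 5"
    using assms by (intro card_cycle) (simp only: S5_iff)
qed

lemma base_bull: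
  assumes "distinct [a, b, c, d, e]"
  shows "base R10 (bull [a, b, c, d, e])"
proof (rule base_R10I[OF _ independent_bull[OF assms]])
  show "bull [a, b, c, d, e] \<subseteq> {T. card T = 3}"
    using assms by (auto simp: card_opp)
  show "card (bull [a, b, c, d, e]) = 5"
    using assms by (intro card_bull) (simp only: S5_iff)
qed

lemma ground_R10: "ground R10 = {T. card T = 3}"
  by (simp add: R10_def)

lemma base_cobase_cycle: "w \<in> S5 \<Longrightarrow> base_cobase R10 (cycle w)"
  by (erule S5_cases) (auto simp del: cycle.simps simp: base_cobase_def ground_R10 compl_cycle intro!: base_cycle)

lemma base_cobase_bull: "w \<in> S5 \<Longrightarrow> base_cobase R10 (bull w)"
  by (erule S5_cases) (auto simp del: bull.simps simp: base_cobase_def ground_R10 compl_bull intro!: base_bull)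

text \<open>The first claim is about \<open>B\<close>, the second about its complement; distinctness
  puts the four triples into the ground set. The elementwise form provides propositional clauses for
  the case checks below.\<close>

lemma base_cobase_no_4_cycle:
  assumes "base_cobase R10 B" "distinct [x, y, z, w]"
  shows "\<not> (opp x y \<in> B \<and> opp y z \<in> B \<and> opp z w \<in> B \<and> opp w x \<in> B)"
    and "opp x y \<in> B \<or> opp y z \<in> B \<or> opp z w \<in> B \<or> opp w x \<in> B"
proof -
  have "indep R10 B" "indep R10 ({T. card T = 3} - B)"
    using assms(1) by (auto simp: base_cobase_def base_def ground_R10)
  from this[THEN indep_R10_no_4_cycle, OF assms(2)] assms(2)
  show "\<not> (opp x y \<in> B \<and> opp y z \<in> B \<and> opp z w \<in> B \<and> opp w x \<in> B)"
    "opp x y \<in> B \<or> opp y z \<in> B \<or> opp z w \<in> B \<or> opp w x \<in> B"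
    by (auto simp: card_opp)
qed

text \<open>Thanks to this, identifying a base only requires locating the edges of a pentagon or
  bull inside it.\<close>

lemma base_eqI: "base M A \<Longrightarrow> base M B \<Longrightarrow> A \<subseteq> B \<Longrightarrow> A = B"
  unfolding base_def by blast

section \<open>Which words name the same pentagon or bull\<close>

lemma cycle_eq_empty: "length w \<noteq> 5 \<Longrightarrow> cycle w = {}"
  by (induction w rule: cycle.induct) simp_all

lemma bull_eq_empty: "length w \<noteq> 5 \<Longrightarrow> bull w = {}"
  by (induction w rule: bull.induct) simp_all

lemma length_5E:
  assumes "length w = 5"
  obtains a b c d e where "w = [a, b, c, d, e]"
  using assms by (auto simp: numeral_eq_Suc length_Suc_conv)

lemma cycle_rev: "cycle (rev w) = cycle w"
  by (cases "length w = 5") (auto simp: cycle_eq_empty opp_commute elim!: length_5E)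

lemma cycle_rotate1: "cycle (rotate1 w) = cycle w"
  by (cases "length w = 5") (auto simp: cycle_eq_empty elim!: length_5E)

lemma bull_rev: "bull (rev w) = bull w"
  by (cases "length w = 5") (auto simp: bull_eq_empty opp_commute elim!: length_5E)

lemma equivclp_invariant:
  assumes "equivclp r x y" and "\<And>x y. r x y \<Longrightarrow> f x = f y"
  shows "f x = f y"
  using assms(1) by (induction rule: equivclp_induct) (auto dest: assms(2))

lemma cycle_eq_if_D5_rel: "(v, w) \<in> D5_rel \<Longrightarrow> cycle v = cycle w"
  unfolding D5_rel_def
  by (clarsimp, erule equivclp_invariant) (auto simp: cycle_rev cycle_rotate1)

lemma bull_eq_if_S2_rel: "(v, w) \<in> S2_rel \<Longrightarrow> bull v = bull w"
  unfolding S2_rel_def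
  by (clarsimp, erule equivclp_invariant) (auto simp: bull_rev)

lemma D5_rel_rotate:
  assumes "v \<in> S5"
  shows "(v, rotate n v) \<in> D5_rel"
proof -
  have "equivclp (\<lambda>x y. y = rev x \<or> y = rotate1 x) v (rotate n v)"
    by (induction n) (auto intro: equivclp_into_equivclp)
  then show ?thesis using assms by (auto simp: D5_rel_def permutations_of_set_def)
qed

lemma S2_rel_rev:
  assumes "v \<in> S5"
  shows "(v, rev v) \<in> S2_rel"
  using assms by (auto simp: S2_rel_def permutations_of_set_def)

text \<open>A bull contains a triangle, a pentagon does not.\<close>

lemma cycle_neq_bull:
  assumes "v \<in> S5" "w \<in> S5"
  shows "cycle v \<noteq> bull w"
proof -
  obtain a b c d e where v: "v = [a, b, c, d, e]" "distinct [a, b, c, d, e]"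
    using S5_cases[OF assms(1)] .
  obtain a' b' c' d' e' where w: "w = [a', b', c', d', e']" "distinct [a', b', c', d', e']"
    using S5_cases[OF assms(2)] .
  have "\<not> (opp b' c' \<in> cycle v \<and> opp c' d' \<in> cycle v \<and> opp b' d' \<in> cycle v)"
    using v w(2) by (auto simp: opp_eq_iff)
  then show ?thesis using w(1) by (metis bull.simps(1) insertCI)
qed

lemma S2_rel_if_bull_eq:
  assumes "v \<in> S5" "w \<in> S5" "bull v = bull w"
  shows "(v, w) \<in> S2_rel"
proof -
  obtain a b c d e where v: "v = [a, b, c, d, e]" "distinct [a, b, c, d, e]"
    using S5_cases[OF assms(1)] .
  obtain a' b' c' d' e' where w: "w = [a', b', c', d', e']" "distinct [a', b', c', d', e']"
    using S5_cases[OF assms(2)] .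
  have *: "opp a' b' \<in> bull v" "opp b' c' \<in> bull v" "opp c' d' \<in> bull v" "opp d' e' \<in> bull v"
    "opp b' d' \<in> bull v"
    unfolding assms(3) w(1) by simp_all
  \<comment> \<open>The triangles of the two bulls coincide, and \<open>c\<close> is the one corner
    without a pendant edge. The pendant edges then fix the ends of the word.\<close>
  have "c' = c \<and> (b' = b \<and> d' = d \<or> b' = d \<and> d' = b)"
    using * v w(2) by (auto simp: opp_eq_iff)
  then have "w = v \<or> w = rev v"
    using *(1,4) v w by (auto simp: opp_eq_iff)
  then show ?thesis
    using S2_rel_rev[OF assms(1)] equiv_class_self[OF equiv_S2_rel assms(1)] by auto
qed

lemma D5_rel_if_cycle_eq:
  assumes "v \<in> S5" "w \<in> S5" "cycle v = cycle w"
  shows "(v, w) \<in> D5_rel"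
proof -
  obtain a b c d e where v: "v = [a, b, c, d, e]" "distinct [a, b, c, d, e]"
    using S5_cases[OF assms(1)] .
  obtain a' b' c' d' e' where w: "w = [a', b', c', d', e']" "distinct [a', b', c', d', e']"
    using S5_cases[OF assms(2)] .
  have *: "opp a' b' \<in> cycle v" "opp b' c' \<in> cycle v" "opp c' d' \<in> cycle v" "opp d' e' \<in> cycle v"
    unfolding assms(3) w(1) by simp_all
  have rot: "rotate 1 v = [b, c, d, e, a]" "rotate 2 v = [c, d, e, a, b]"
      "rotate 3 v = [d, e, a, b, c]" "rotate 4 v = [e, a, b, c, d]"
    unfolding v(1) by (simp_all add: numeral_eq_Suc)
  \<comment> \<open>The first two edges of \<open>w\<close> form a path of length two in the
    pentagon \<open>v\<close>: five midpoints, two directions. Continuing it forwards gives a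
    rotation of \<open>v\<close>, backwards the reversal of one.\<close>
  have "[a', b', c'] \<in> {[a, b, c], [b, c, d], [c, d, e], [d, e, a], [e, a, b],
      [c, b, a], [d, c, b], [e, d, c], [a, e, d], [b, a, e]}"
    using *(1,2) v w(2) by (auto simp: opp_eq_iff)
  then have "w \<in> {v, rotate 1 v, rotate 2 v, rotate 3 v, rotate 4 v} \<or>
    rev w \<in> {v, rotate 1 v, rotate 2 v, rotate 3 v, rotate 4 v}"
    unfolding rot using *(3,4) v w by (elim insertE emptyE) (simp_all add: opp_eq_iff, argo+)
  moreover have "(v, u) \<in> D5_rel" if "u \<in> {v, rotate 1 v, rotate 2 v, rotate 3 v, rotate 4 v}" for u
    using that D5_rel_rotate[OF assms(1), of 0] D5_rel_rotate[OF assms(1), of 1]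
      D5_rel_rotate[OF assms(1), of 2] D5_rel_rotate[OF assms(1), of 3] D5_rel_rotate[OF assms(1), of 4]
    by auto
  moreover have "(w, rev w) \<in> D5_rel"
    using assms(2) by (auto simp: D5_rel_def permutations_of_set_def)
  ultimately show ?thesis
    using equiv_D5_rel by (meson equivE symE transE)
qed

section \<open>Classification of the base-cobases\<close>

lemma base_cobase_compl: "base_cobase R10 B \<Longrightarrow> base_cobase R10 ({T. card T = 3} - B)"
  by (auto simp: base_cobase_def ground_R10 base_def R10_def double_diff)

text \<open>Two edges inside \<open>{b, c, d}\<close>, or two edges from \<open>e\<close> into it,
  would close a 4-cycle through \<open>a\<close>. Since the complement has no 4-cycle on
  \<open>b, c, d, e\<close>, there is exactly one edge inside \<open>{b, c, d}\<close>, and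
  \<open>e\<close> is joined to one of its ends. The triangle consists of \<open>a\<close> and that
  edge; the third neighbour of \<open>a\<close> and the point \<open>e\<close> are pendant. The
  choices of the edge and of its end give the six words.\<close>

lemma bull_if_degree_3:
  assumes "base_cobase R10 B" "distinct [a, b, c, d, e]" "opp a b \<in> B" "opp a c \<in> B" "opp a d \<in> B"
  shows "\<exists>w\<in>S5. bull w = B"
proof -
  note * = base_cobase_no_4_cycle[OF assms(1)]
  have "\<exists>w\<in>{[b, a, c, d, e], [b, a, d, c, e], [c, a, b, d, e], [c, a, d, b, e], [d, a, b, c, e],
    [d, a, c, b, e]}. bull w \<subseteq> B"
    using *(1)[of a b c d] *(1)[of a b d c] *(1)[of a c b d] *(1)[of a b e c] *(1)[of a b e d]
      *(1)[of a c e d] *(2)[of b c d e] *(2)[of b c e d] *(2)[of b d c e] assms(2-)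
    by (simp add: opp_commute) argo
  then obtain w where w: "w \<in> {[b, a, c, d, e], [b, a, d, c, e], [c, a, b, d, e], [c, a, d, b, e],
    [d, a, b, c, e], [d, a, c, b, e]}" and sub: "bull w \<subseteq> B" ..
  have "w \<in> S5"
    using w assms(2) by (elim insertE emptyE) (simp_all add: S5_iff eq_commute)
  then show ?thesis
    using base_eqI[OF _ _ sub] base_cobase_bull[of w] assms(1) by (auto simp: base_cobase_def)
qed

text \<open>Apply the previous case to the complement; the complement of the resulting bull is again
  a bull.\<close>

lemma bull_if_codegree_3:
  assumes "base_cobase R10 B" "distinct [a, b, c, d, e]" "opp a b \<notin> B" "opp a c \<notin> B" "opp a d \<notin> B"
  shows "\<exists>w\<in>S5. bull w = B"
proof -
  have "\<exists>w\<in>S5. bull w = {T. card T = 3} - B"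
    using assms(2-) by (intro bull_if_degree_3[OF base_cobase_compl[OF assms(1)], of a b c d e]) (auto simp: card_opp)
  then obtain w where "w \<in> S5" "bull w = {T. card T = 3} - B" ..
  moreover have "B \<subseteq> {T. card T = 3}"
    using assms(1) by (simp add: base_cobase_def base_def R10_def)
  ultimately have "B = {T. card T = 3} - bull w"
    by auto
  with \<open>w \<in> S5\<close> show ?thesis
    by (elim S5_cases) (auto simp: compl_bull S5_iff simp del: bull.simps intro!: bexI)
qed

lemma base_cobase_cases:
  assumes "base_cobase R10 B"
  obtains w where "w \<in> S5" "B = cycle w" | w where "w \<in> S5" "B = bull w"
proof (cases "\<exists>w\<in>S5. bull w = B")
  case False
  have deg: "\<not> (opp a b \<in> B \<and> opp a c \<in> B \<and> opp a d \<in> B)"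
    and codeg: "opp a b \<in> B \<or> opp a c \<in> B \<or> opp a d \<in> B"
    if "distinct [a, b, c, d, e]" for a b c d e
    using bull_if_degree_3[OF assms that] bull_if_codegree_3[OF assms that] False by blast+
  \<comment> \<open>All degrees are now two. The point \<open>a\<close> is \<open>0\<close>, and the
    six instances of \<open>that\<close> run through the possible pairs \<open>b\<close>,
    \<open>e\<close> of its neighbours.\<close>
  obtain a b c d e where
    w: "distinct [a, b, c, d, e]" "opp a b \<in> B" "opp a e \<in> B" "opp a c \<notin> B" "opp a d \<notin> B"
  proof -
    show thesis
      using deg[of 0 1 2 3 4] deg[of 0 1 2 4 3] deg[of 0 1 3 4 2] deg[of 0 2 3 4 1]
        codeg[of 0 1 2 3 4] codeg[of 0 1 2 4 3] codeg[of 0 1 3 4 2] codeg[of 0 2 3 4 1]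
        that[of 0 1 2 3 4] that[of 0 1 2 4 3] that[of 0 1 3 4 2] that[of 0 2 1 3 4] that[of 0 2 1 4 3] that[of 0 3 1 2 4]
      by (simp; argo)
  qed
  \<comment> \<open>Each of \<open>c\<close> and \<open>d\<close> misses \<open>a\<close>, hence has
    at least two neighbours among the other three points, while \<open>b\<close> and
    \<open>e\<close> can each take only one of \<open>c\<close> and \<open>d\<close>. So
    \<open>c\<close> and \<open>d\<close> are adjacent, and one is joined to \<open>b\<close>, the
    other to \<open>e\<close>.\<close>
  have "cycle [a, b, c, d, e] \<subseteq> B \<or> cycle [a, b, d, c, e] \<subseteq> B"
    using codeg[of c a b d e] codeg[of c a b e d] codeg[of d a b c e] codeg[of d a b e c]
      deg[of b a c d e] deg[of e a c d b] w
    by (simp add: opp_commute) argo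
  then obtain w where "w \<in> S5" "cycle w \<subseteq> B"
    using w(1) by (metis S5_iff distinct_length_2_or_more)
  then show ?thesis
    using that(1)[of w] base_eqI[of R10 "cycle w" B] base_cobase_cycle[of w] assms by (auto simp: base_cobase_def)
qed (use that in blast)

section \<open>Exchanging one edge of a pentagon or bull\<close>

lemma sym_diff_card_2_imp_swap:
  assumes "finite A" "finite B" "card A = card B" "card (sym_diff A B) = 2"
  obtains x y where "x \<in> A" "y \<in> B - A" "B = insert y (A - {x})"
proof -
  have "card (A - B) + card (B - A) = 2"
    using assms by (subst card_Un_disjoint[symmetric]) auto
  moreover have "card (A - B) = card (B - A)"
    using assms by (simp add: card_Diff_subset_Int Int_commute)
  ultimately have "card (A - B) = 1" "card (B - A) = 1"
    by auto
  then obtain x y where "A - B = {x}" "B - A = {y}"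
    by (auto simp: card_1_singleton_iff)
  then show ?thesis
    by (intro that[of x y]) auto
qed

lemma distinct_5D:
  assumes "distinct [a, b, c, d, e]"
  shows "a \<noteq> b" "a \<noteq> c" "a \<noteq> d" "a \<noteq> e" "b \<noteq> a"
    "b \<noteq> c" "b \<noteq> d" "b \<noteq> e" "c \<noteq> a" "c \<noteq> b"
    "c \<noteq> d" "c \<noteq> e" "d \<noteq> a" "d \<noteq> b" "d \<noteq> c"
    "d \<noteq> e" "e \<noteq> a" "e \<noteq> b" "e \<noteq> c" "e \<noteq> d"
  using assms by auto

text \<open>Trading the chord for the edge between the ends of the path closes a pentagon. Two
  exchanges slide a pendant edge over to \<open>c\<close>; the other two make \<open>a\<close> or
  \<open>e\<close> the apex of the triangle over \<open>b d\<close> and turn \<open>c\<close> into a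
  pendant point.\<close>

lemma bull_swaps:
  assumes "distinct [a, b, c, d, e]"
  shows "insert (opp a e) (bull [a, b, c, d, e] - {opp b d}) = cycle [a, b, c, d, e]"
    and "insert (opp a d) (bull [a, b, c, d, e] - {opp c d}) = bull [c, b, a, d, e]"
    and "insert (opp a c) (bull [a, b, c, d, e] - {opp a b}) = bull [a, c, b, d, e]"
    and "insert (opp c e) (bull [a, b, c, d, e] - {opp d e}) = bull [a, b, d, c, e]"
    and "insert (opp b e) (bull [a, b, c, d, e] - {opp b c}) = bull [a, b, e, d, c]"
  by (simp_all add: opp_eq_iff distinct_5D[OF assms] insert_Diff_if) (auto simp: opp_commute)

text \<open>The deleted side is the one disjoint from the inserted diagonal. The word on the right
  is the path that remains after the deletion.\<close>

lemma cycle_swaps: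
  assumes "distinct [a, b, c, d, e]"
  shows "insert (opp b d) (cycle [a, b, c, d, e] - {opp a e}) = bull [a, b, c, d, e]"
    and "insert (opp c e) (cycle [a, b, c, d, e] - {opp a b}) = bull [b, c, d, e, a]"
    and "insert (opp a d) (cycle [a, b, c, d, e] - {opp b c}) = bull [c, d, e, a, b]"
    and "insert (opp b e) (cycle [a, b, c, d, e] - {opp c d}) = bull [d, e, a, b, c]"
    and "insert (opp a c) (cycle [a, b, c, d, e] - {opp d e}) = bull [e, a, b, c, d]"
  by (simp_all add: opp_eq_iff distinct_5D[OF assms] insert_Diff_if) (auto simp: opp_commute)

lemma bull_neighbours:
  assumes w: "distinct [a, b, c, d, e]" and "base_cobase R10 B" "card B = 5"
    and "card (sym_diff (bull [a, b, c, d, e]) B) = 2"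
  shows "B \<in> {cycle [a, b, c, d, e], bull [c, b, a, d, e], bull [a, c, b, d, e],
    bull [a, b, d, c, e], bull [a, b, e, d, c]}"
proof -
  have "card (bull [a, b, c, d, e]) = card B"
    using w assms(3) card_bull[of "[a, b, c, d, e]"] by (simp only: S5_iff)
  from sym_diff_card_2_imp_swap[OF _ _ this assms(4)] obtain x y where
    x: "x \<in> bull [a, b, c, d, e]" and y': "y \<in> B - bull [a, b, c, d, e]"
    and B: "B = insert y (bull [a, b, c, d, e] - {x})"
    by auto
  moreover have "B \<subseteq> {T. card T = 3}"
    using assms(2) by (simp add: base_cobase_def base_def R10_def)
  ultimately have y: "y \<in> bull [d, a, c, e, b]"
    using compl_bull[OF w] by blast
  note no_C4 = base_cobase_no_4_cycle[OF assms(2)]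
  have in_iff: "T \<in> B \<longleftrightarrow> x \<noteq> T" if "T \<in> bull [a, b, c, d, e]" for T
    using that y' unfolding B by auto
  have out_iff: "T \<in> B \<longleftrightarrow> y = T" if "T \<notin> bull [a, b, c, d, e]" for T
    using that unfolding B by auto
  note neq = opp_eq_iff distinct_5D[OF w]
  have B_iff: "opp a b \<in> B \<longleftrightarrow> x \<noteq> opp a b"
    "opp b c \<in> B \<longleftrightarrow> x \<noteq> opp b c"
    "opp c d \<in> B \<longleftrightarrow> x \<noteq> opp c d"
    "opp d e \<in> B \<longleftrightarrow> x \<noteq> opp d e"
    "opp b d \<in> B \<longleftrightarrow> x \<noteq> opp b d"
    by (simp_all add: in_iff opp_commute)
  have B_iff': "opp a c \<in> B \<longleftrightarrow> y = opp a c"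
    "opp a d \<in> B \<longleftrightarrow> y = opp a d"
    "opp a e \<in> B \<longleftrightarrow> y = opp a e"
    "opp b e \<in> B \<longleftrightarrow> y = opp b e"
    "opp c e \<in> B \<longleftrightarrow> y = opp c e"
    by (simp_all add: out_iff opp_commute neq)
  have x': "x = opp a b \<or> x = opp b c \<or> x = opp c d \<or> x = opp d e \<or> x = opp b d"
    using x by (auto simp: opp_commute)
  have y'': "y = opp a c \<or> y = opp a d \<or> y = opp a e \<or> y = opp b e \<or> y = opp c e"
    using y by (auto simp: opp_commute)
  \<comment> \<open>The first five clauses exclude 4-cycles in \<open>B\<close>, the last five
    4-cycles in its complement. Edges are written in alphabetical order so that \<open>B_iff\<close>
    and \<open>B_iff'\<close> turn them into conditions on \<open>x\<close> and
    \<open>y\<close>.\<close>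
  have clauses: "\<not> (opp a b \<in> B \<and> opp b c \<in> B \<and> opp c d \<in> B \<and> opp a d \<in> B)"
    "\<not> (opp a b \<in> B \<and> opp b d \<in> B \<and> opp c d \<in> B \<and> opp a c \<in> B)"
    "\<not> (opp a b \<in> B \<and> opp b d \<in> B \<and> opp d e \<in> B \<and> opp a e \<in> B)"
    "\<not> (opp b c \<in> B \<and> opp c d \<in> B \<and> opp d e \<in> B \<and> opp b e \<in> B)"
    "\<not> (opp b c \<in> B \<and> opp c e \<in> B \<and> opp d e \<in> B \<and> opp b d \<in> B)"
    "opp a b \<in> B \<or> opp b e \<in> B \<or> opp c e \<in> B \<or> opp a c \<in> B"
    "opp a c \<in> B \<or> opp b c \<in> B \<or> opp b e \<in> B \<or> opp a e \<in> B"
    "opp a c \<in> B \<or> opp c e \<in> B \<or> opp d e \<in> B \<or> opp a d \<in> B"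
    "opp a d \<in> B \<or> opp b d \<in> B \<or> opp b e \<in> B \<or> opp a e \<in> B"
    "opp a d \<in> B \<or> opp c d \<in> B \<or> opp c e \<in> B \<or> opp a e \<in> B"
    using no_C4(1)[of a b c d] no_C4(1)[of a b d c] no_C4(1)[of a b d e] no_C4(1)[of b c d e] no_C4(1)[of b c e d]
      no_C4(2)[of a b e c] no_C4(2)[of a c b e] no_C4(2)[of a c e d] no_C4(2)[of a d b e] no_C4(2)[of a d c e]
    by (simp_all add: opp_commute neq)
  \<comment> \<open>For instance, when \<open>opp a b\<close> is removed, the sixth clause leaves
    \<open>opp b e\<close>, \<open>opp c e\<close> and \<open>opp a c\<close> for \<open>y\<close>,
    and the fourth and fifth exclude the first two.\<close>
  have "x = opp a b \<Longrightarrow> y = opp a c"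
    "x = opp b c \<Longrightarrow> y = opp b e"
    "x = opp c d \<Longrightarrow> y = opp a d"
    "x = opp d e \<Longrightarrow> y = opp c e"
    "x = opp b d \<Longrightarrow> y = opp a e"
    using clauses[unfolded B_iff B_iff'] y'' by (simp_all add: neq)
  with x' show ?thesis
    unfolding B by (elim disjE) (simp_all only: bull_swaps[OF w] insert_iff simp_thms)
qed

lemma cycle_neighbours:
  assumes w: "distinct [a, b, c, d, e]" and "base_cobase R10 B" "card B = 5"
    and "card (sym_diff (cycle [a, b, c, d, e]) B) = 2"
  shows "B \<in> {bull [a, b, c, d, e], bull [b, c, d, e, a], bull [c, d, e, a, b],
    bull [d, e, a, b, c], bull [e, a, b, c, d]}"
proof -
  have "card (cycle [a, b, c, d, e]) = card B"
    using w assms(3) card_cycle[of "[a, b, c, d, e]"] by (simp only: S5_iff)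
  from sym_diff_card_2_imp_swap[OF _ _ this assms(4)] obtain x y where
    x: "x \<in> cycle [a, b, c, d, e]" and y': "y \<in> B - cycle [a, b, c, d, e]"
    and B: "B = insert y (cycle [a, b, c, d, e] - {x})"
    by auto
  moreover have "B \<subseteq> {T. card T = 3}"
    using assms(2) by (simp add: base_cobase_def base_def R10_def)
  ultimately have y: "y \<in> cycle [a, c, e, b, d]"
    using compl_cycle[OF w] by blast
  note no_C4 = base_cobase_no_4_cycle[OF assms(2)]
  have in_iff: "T \<in> B \<longleftrightarrow> x \<noteq> T" if "T \<in> cycle [a, b, c, d, e]" for T
    using that y' unfolding B by auto
  have out_iff: "T \<in> B \<longleftrightarrow> y = T" if "T \<notin> cycle [a, b, c, d, e]" for T
    using that unfolding B by auto
  note neq = opp_eq_iff distinct_5D[OF w]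
  have B_iff: "opp a b \<in> B \<longleftrightarrow> x \<noteq> opp a b"
    "opp b c \<in> B \<longleftrightarrow> x \<noteq> opp b c"
    "opp c d \<in> B \<longleftrightarrow> x \<noteq> opp c d"
    "opp d e \<in> B \<longleftrightarrow> x \<noteq> opp d e"
    "opp a e \<in> B \<longleftrightarrow> x \<noteq> opp a e"
    by (simp_all add: in_iff opp_commute)
  have B_iff': "opp a c \<in> B \<longleftrightarrow> y = opp a c"
    "opp a d \<in> B \<longleftrightarrow> y = opp a d"
    "opp b d \<in> B \<longleftrightarrow> y = opp b d"
    "opp b e \<in> B \<longleftrightarrow> y = opp b e"
    "opp c e \<in> B \<longleftrightarrow> y = opp c e"
    by (simp_all add: out_iff opp_commute neq)
  have x': "x = opp a b \<or> x = opp b c \<or> x = opp c d \<or> x = opp d e \<or> x = opp a e"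
    using x by (auto simp: opp_commute)
  have y'': "y = opp a c \<or> y = opp a d \<or> y = opp b d \<or> y = opp b e \<or> y = opp c e"
    using y by (auto simp: opp_commute)
  have clauses: "\<not> (opp a b \<in> B \<and> opp b c \<in> B \<and> opp c d \<in> B \<and> opp a d \<in> B)"
    "\<not> (opp a b \<in> B \<and> opp b c \<in> B \<and> opp c e \<in> B \<and> opp a e \<in> B)"
    "\<not> (opp a b \<in> B \<and> opp b d \<in> B \<and> opp d e \<in> B \<and> opp a e \<in> B)"
    "\<not> (opp a c \<in> B \<and> opp c d \<in> B \<and> opp d e \<in> B \<and> opp a e \<in> B)"
    "\<not> (opp b c \<in> B \<and> opp c d \<in> B \<and> opp d e \<in> B \<and> opp b e \<in> B)"
    "opp a b \<in> B \<or> opp b e \<in> B \<or> opp c e \<in> B \<or> opp a c \<in> B"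
    "opp a c \<in> B \<or> opp b c \<in> B \<or> opp b d \<in> B \<or> opp a d \<in> B"
    "opp a c \<in> B \<or> opp c e \<in> B \<or> opp d e \<in> B \<or> opp a d \<in> B"
    "opp a d \<in> B \<or> opp b d \<in> B \<or> opp b e \<in> B \<or> opp a e \<in> B"
    "opp b d \<in> B \<or> opp c d \<in> B \<or> opp c e \<in> B \<or> opp b e \<in> B"
    using no_C4(1)[of a b c d] no_C4(1)[of a b c e] no_C4(1)[of a b d e] no_C4(1)[of a c d e] no_C4(1)[of b c d e]
      no_C4(2)[of a b e c] no_C4(2)[of a c b d] no_C4(2)[of a c e d] no_C4(2)[of a d b e] no_C4(2)[of b d c e]
    by (simp_all add: opp_commute neq)
  \<comment> \<open>For instance, after removal of \<open>opp a b\<close> the edges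
    \<open>opp a c\<close> and \<open>opp b e\<close> would close 4-cycles with the remaining path,
    and the sixth clause then forces \<open>opp c e\<close>.\<close>
  have "x = opp a b \<Longrightarrow> y = opp c e"
    "x = opp b c \<Longrightarrow> y = opp a d"
    "x = opp c d \<Longrightarrow> y = opp b e"
    "x = opp d e \<Longrightarrow> y = opp a c"
    "x = opp a e \<Longrightarrow> y = opp b d"
    using clauses[unfolded B_iff B_iff'] y'' by (simp_all add: neq)
  with x' show ?thesis
    unfolding B by (elim disjE) (simp_all only: cycle_swaps[OF w] insert_iff simp_thms)
qed

lemma card_sym_diff_swap:
  assumes "x \<in> A" "y \<notin> A"
  shows "card (sym_diff A (insert y (A - {x}))) = 2"
proof -
  have "sym_diff A (insert y (A - {x})) = {x, y}"
    using assms by auto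
  moreover have "x \<noteq> y"
    using assms by auto
  ultimately show ?thesis
    by simp
qed

lemma card_sym_diff_bull:
  assumes w: "distinct [a, b, c, d, e]"
    and "B \<in> {cycle [a, b, c, d, e], bull [c, b, a, d, e], bull [a, c, b, d, e],
      bull [a, b, d, c, e], bull [a, b, e, d, c]}"
  shows "card (sym_diff (bull [a, b, c, d, e]) B) = 2"
proof -
  note neq = opp_eq_iff distinct_5D[OF w]
  have mem: "opp a b \<in> bull [a, b, c, d, e]"
    "opp b c \<in> bull [a, b, c, d, e]"
    "opp c d \<in> bull [a, b, c, d, e]"
    "opp d e \<in> bull [a, b, c, d, e]"
    "opp b d \<in> bull [a, b, c, d, e]"
    by (simp_all add: opp_commute)
  \<comment> \<open>The order matters: each missing edge stands at the position of its exchange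
    partner in \<open>mem\<close>, so \<open>bull_swaps\<close> rewrites the swapped sets to the
    listed ones.\<close>
  have not_mem: "opp a c \<notin> bull [a, b, c, d, e]"
    "opp b e \<notin> bull [a, b, c, d, e]"
    "opp a d \<notin> bull [a, b, c, d, e]"
    "opp c e \<notin> bull [a, b, c, d, e]"
    "opp a e \<notin> bull [a, b, c, d, e]"
    by (simp_all add: neq)
  note swap = card_sym_diff_swap[OF mem(1) not_mem(1)]
    card_sym_diff_swap[OF mem(2) not_mem(2)]
    card_sym_diff_swap[OF mem(3) not_mem(3)]
    card_sym_diff_swap[OF mem(4) not_mem(4)]
    card_sym_diff_swap[OF mem(5) not_mem(5)]
  show ?thesis
    using assms(2) by (elim insertE emptyE) (simp_all only: swap[unfolded bull_swaps[OF w]])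
qed

lemma card_sym_diff_cycle:
  assumes w: "distinct [a, b, c, d, e]"
    and "B \<in> {bull [a, b, c, d, e], bull [b, c, d, e, a], bull [c, d, e, a, b],
      bull [d, e, a, b, c], bull [e, a, b, c, d]}"
  shows "card (sym_diff (cycle [a, b, c, d, e]) B) = 2"
proof -
  note neq = opp_eq_iff distinct_5D[OF w]
  have mem: "opp a b \<in> cycle [a, b, c, d, e]"
    "opp b c \<in> cycle [a, b, c, d, e]"
    "opp c d \<in> cycle [a, b, c, d, e]"
    "opp d e \<in> cycle [a, b, c, d, e]"
    "opp a e \<in> cycle [a, b, c, d, e]"
    by (simp_all add: opp_commute)
  \<comment> \<open>Each diagonal stands at the position of the side disjoint from it.\<close>
  have not_mem: "opp c e \<notin> cycle [a, b, c, d, e]"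
    "opp a d \<notin> cycle [a, b, c, d, e]"
    "opp b e \<notin> cycle [a, b, c, d, e]"
    "opp a c \<notin> cycle [a, b, c, d, e]"
    "opp b d \<notin> cycle [a, b, c, d, e]"
    by (simp_all add: neq)
  note swap = card_sym_diff_swap[OF mem(1) not_mem(1)]
    card_sym_diff_swap[OF mem(2) not_mem(2)]
    card_sym_diff_swap[OF mem(3) not_mem(3)]
    card_sym_diff_swap[OF mem(4) not_mem(4)]
    card_sym_diff_swap[OF mem(5) not_mem(5)]
  show ?thesis
    using assms(2) by (elim insertE emptyE) (simp_all only: swap[unfolded cycle_swaps[OF w]])
qed

section \<open>From classes of words to base-cobases\<close>

definition realize :: "5 list set + 5 list set \<Rightarrow> 5 set set" where
  "realize = case_sum (\<lambda>X. \<Union>(cycle ` X)) (\<lambda>X. \<Union>(bull ` X))"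

text \<open>The union in \<open>realize\<close> evaluates \<open>cycle\<close> without choosing a
  representative: \<open>cycle\<close> is constant on the nonempty class, so the union is its common
  value.\<close>

lemma realize_D5_class:
  assumes "w \<in> S5"
  shows "realize (D5_class w) = cycle w"
  unfolding realize_def D5_class_def sum.case
proof (rule SUP_eq_const)
  show "D5_rel `` {w} \<noteq> {}"
    using equiv_class_self[OF equiv_D5_rel assms] by blast
  fix v
  assume "v \<in> D5_rel `` {w}"
  then have "(w, v) \<in> D5_rel"
    by simp
  then show "cycle v = cycle w"
    by (rule cycle_eq_if_D5_rel[symmetric])
qed

lemma realize_S2_class:
  assumes "w \<in> S5"
  shows "realize (S2_class w) = bull w"
  unfolding realize_def S2_class_def sum.case
proof (rule SUP_eq_const)
  show "S2_rel `` {w} \<noteq> {}"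
    using equiv_class_self[OF equiv_S2_rel assms] by blast
  fix v
  assume "v \<in> S2_rel `` {w}"
  then have "(w, v) \<in> S2_rel"
    by simp
  then show "bull v = bull w"
    by (rule bull_eq_if_S2_rel[symmetric])
qed

lemma quotient_sum_eq: "(S5 // D5_rel) <+> (S5 // S2_rel) = D5_class ` S5 \<union> S2_class ` S5"
  by (simp add: Plus_def quotient_def UNION_singleton_eq_range image_image D5_class_def S2_class_def)

lemma D5_class_eq_if_cycle_eq:
  "v \<in> S5 \<Longrightarrow> w \<in> S5 \<Longrightarrow> cycle v = cycle w \<Longrightarrow> D5_class v = D5_class w"
  using equiv_class_eq[OF equiv_D5_rel D5_rel_if_cycle_eq[of v w]] by (simp add: D5_class_def)

lemma S2_class_eq_if_bull_eq:
  "v \<in> S5 \<Longrightarrow> w \<in> S5 \<Longrightarrow> bull v = bull w \<Longrightarrow> S2_class v = S2_class w"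
  using equiv_class_eq[OF equiv_S2_rel S2_rel_if_bull_eq[of v w]] by (simp add: S2_class_def)

text \<open>Within one kind of class, equal images mean related words; across the two kinds a
  triangle tells the images apart.\<close>

lemma inj_on_realize: "inj_on realize (D5_class ` S5 \<union> S2_class ` S5)"
proof (rule inj_onI)
  fix x y
  assume x: "x \<in> D5_class ` S5 \<union> S2_class ` S5" and y: "y \<in> D5_class ` S5 \<union> S2_class ` S5"
    and eq: "realize x = realize y"
  from x obtain v where v: "v \<in> S5" "x = D5_class v \<or> x = S2_class v"
    by blast
  from y obtain w where w: "w \<in> S5" "y = D5_class w \<or> y = S2_class w"
    by blast
  note realize = realize_D5_class[OF v(1)] realize_S2_class[OF v(1)]
    realize_D5_class[OF w(1)] realize_S2_class[OF w(1)]
  show "x = y"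
    using v(2) w(2) eq cycle_neq_bull[OF v(1) w(1)] cycle_neq_bull[OF w(1) v(1)]
      D5_class_eq_if_cycle_eq[OF v(1) w(1)] S2_class_eq_if_bull_eq[OF v(1) w(1)]
    by (elim disjE) (simp_all only: realize)
qed

lemma realize_image: "realize ` (D5_class ` S5 \<union> S2_class ` S5) = {B. base_cobase R10 B}"
proof -
  have "realize ` (D5_class ` S5 \<union> S2_class ` S5) = cycle ` S5 \<union> bull ` S5"
    by (simp add: image_Un image_image realize_D5_class realize_S2_class)
  also have "\<dots> = {B. base_cobase R10 B}"
    by (auto intro: base_cobase_cycle base_cobase_bull elim: base_cobase_cases)
  finally show ?thesis .
qed

section \<open>The graph on the classes and the isomorphism\<close>

lemma digraph_iso_with_projI:
  assumes "pair_wf_digraph G" "pair_wf_digraph H" "bij_betw f (pverts H) (pverts G)"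
    and "\<And>u v. u \<in> pverts H \<Longrightarrow> v \<in> pverts H \<Longrightarrow> (f u, f v) \<in> parcs G \<longleftrightarrow> (u, v) \<in> parcs H"
  shows "digraph_iso (with_proj G) (with_proj H)"
proof -
  interpret G: pair_wf_digraph G by fact
  interpret H: pair_wf_digraph H by fact
  \<comment> \<open>Arcs are pairs of vertices, so the vertex map dictates the arc map.\<close>
  let ?f = "\<lparr> iso_verts = f, iso_arcs = map_prod f f, iso_head = snd, iso_tail = fst \<rparr>"
  have parcs: "parcs G = map_prod f f ` parcs H"
  proof (intro equalityI subrelI)
    fix x y
    assume xy: "(x, y) \<in> parcs G"
    have "x \<in> f ` pverts H" "y \<in> f ` pverts H"
      using bij_betw_imp_surj_on[OF assms(3)] G.arc_fst_in_verts[OF xy] G.arc_snd_in_verts[OF xy] by simp_all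
    then obtain u v where "u \<in> pverts H" "v \<in> pverts H" "x = f u" "y = f v"
      by (elim imageE)
    with xy assms(4)[of u v] show "(x, y) \<in> map_prod f f ` parcs H"
      by auto
  next
    fix x y
    assume "(x, y) \<in> map_prod f f ` parcs H"
    then obtain u v where uv: "(u, v) \<in> parcs H" "x = f u" "y = f v"
      by auto
    with H.arc_fst_in_verts[OF uv(1)] H.arc_snd_in_verts[OF uv(1)] assms(4)[of u v]
    show "(x, y) \<in> parcs G"
      by simp
  qed
  have inj: "inj_on f (pverts H)"
    using assms(3) by (rule bij_betw_imp_inj_on)
  have "inj_on (map_prod f f) (parcs H)"
    by (rule inj_on_subset[OF map_prod_inj_on[OF inj inj]])
      (auto dest: H.arc_fst_in_verts H.arc_snd_in_verts)
  with inj have "H.digraph_isomorphism ?f"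
    by (auto simp: H.digraph_isomorphism_def H.wf_digraph_axioms)
  moreover have "with_proj G = app_iso ?f (with_proj H)"
    using assms(3) parcs by (simp add: with_proj_def app_iso_def bij_betw_def)
  \<comment> \<open>As \<open>f\<close> runs from \<open>H\<close> to \<open>G\<close>, the
    isomorphism appears in this direction and is reversed afterwards.\<close>
  ultimately have "digraph_iso (with_proj H) (with_proj G)"
    unfolding digraph_iso_def by blast
  then show ?thesis
    by (rule digraph_iso_swap[OF H.wf_digraph_axioms])
qed

text \<open>Adjacency is pulled back along \<open>realize\<close>, which makes the isomorphism
  immediate and moves the work to computing neighbours.\<close>

definition word_class_graph :: "(5 list set + 5 list set) pair_pre_digraph" where
  "word_class_graph = \<lparr>
     pverts = D5_class ` S5 \<union> S2_class ` S5,
     parcs = {(u, v). u \<in> D5_class ` S5 \<union> S2_class ` S5 \<and> v \<in> D5_class ` S5 \<union> S2_class ` S5 \<and>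
       card (sym_diff (realize u) (realize v)) = 2} \<rparr>"

lemma pverts_word_class_graph: "pverts word_class_graph = (S5 // D5_rel) <+> (S5 // S2_rel)"
  by (simp add: word_class_graph_def quotient_sum_eq)

lemma pair_graph_word_class_graph: "pair_graph word_class_graph"
proof
  show "finite (parcs word_class_graph)"
    by (rule finite_subset[of _ "pverts word_class_graph \<times> pverts word_class_graph"])
      (auto simp: word_class_graph_def)
  show "symmetric (with_proj word_class_graph)"
    by (auto simp: symmetric_def sym_def word_class_graph_def Un_commute)
qed (auto simp: word_class_graph_def)

lemma card_realize: "v \<in> D5_class ` S5 \<union> S2_class ` S5 \<Longrightarrow> card (realize v) = 5"
  by (elim UnE imageE) (simp_all add: realize_D5_class realize_S2_class card_cycle card_bull)

text \<open>Neighbours can be computed among base-cobases and pulled back by injectivity of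
  \<open>realize\<close>. The third premise may assume \<open>card B = 5\<close>, which supplies the
  equal cardinalities behind the exchange argument.\<close>

lemma neighbors_word_class_graph:
  assumes "u \<in> D5_class ` S5 \<union> S2_class ` S5" "N \<subseteq> D5_class ` S5 \<union> S2_class ` S5"
    and "\<And>B. base_cobase R10 B \<Longrightarrow> card B = 5 \<Longrightarrow> card (sym_diff (realize u) B) = 2 \<longleftrightarrow> B \<in> realize ` N"
  shows "neighbors word_class_graph u = N"
proof -
  let ?V = "D5_class ` S5 \<union> S2_class ` S5"
  have "(u, v) \<in> parcs word_class_graph \<longleftrightarrow> v \<in> N" for v
  proof (cases "v \<in> ?V")
    case True
    then have "base_cobase R10 (realize v)"
      using realize_image by blast
    from assms(3)[OF this card_realize[OF True]]
    have "(u, v) \<in> parcs word_class_graph \<longleftrightarrow> realize v \<in> realize ` N"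
      using True assms(1) by (simp add: word_class_graph_def)
    then show ?thesis
      using inj_on_image_mem_iff[OF inj_on_realize True assms(2)] by simp
  qed (use assms(2) in \<open>auto simp: word_class_graph_def\<close>)
  then show ?thesis
    by (auto simp: neighbors_def)
qed

lemma neighbors_S2_class:
  assumes "distinct [a, b, c, d, e]"
  shows "neighbors word_class_graph (S2_class [a, b, c, d, e]) =
        {D5_class [a, b, c, d, e], S2_class [c, b, a, d, e], S2_class [a, c, b, d, e],
         S2_class [a, b, d, c, e], S2_class [a, b, e, d, c]}" (is "_ = ?N")
proof (rule neighbors_word_class_graph)
  have S5: "[a, b, c, d, e] \<in> S5" "[c, b, a, d, e] \<in> S5" "[a, c, b, d, e] \<in> S5"
    "[a, b, d, c, e] \<in> S5" "[a, b, e, d, c] \<in> S5"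
    using assms by (auto simp: S5_iff)
  then show "S2_class [a, b, c, d, e] \<in> D5_class ` S5 \<union> S2_class ` S5"
    "?N \<subseteq> D5_class ` S5 \<union> S2_class ` S5"
    by blast+
  fix B
  assume B: "base_cobase R10 B" "card B = 5"
  have "realize ` ?N = {cycle [a, b, c, d, e], bull [c, b, a, d, e], bull [a, c, b, d, e],
    bull [a, b, d, c, e], bull [a, b, e, d, c]}"
    using S5 by (simp only: image_insert image_empty realize_S2_class realize_D5_class)
  \<comment> \<open>\<open>bull_neighbours\<close> gives the forward implication,
    \<open>card_sym_diff_bull\<close> the converse.\<close>
  with bull_neighbours[OF assms B] card_sym_diff_bull[OF assms] S5(1)
  show "card (sym_diff (realize (S2_class [a, b, c, d, e])) B) = 2 \<longleftrightarrow> B \<in> realize ` ?N"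
    by (metis realize_S2_class)
qed

lemma neighbors_D5_class:
  assumes "distinct [a, b, c, d, e]"
  shows "neighbors word_class_graph (D5_class [a, b, c, d, e]) =
        {S2_class [a, b, c, d, e], S2_class [b, c, d, e, a], S2_class [c, d, e, a, b],
         S2_class [d, e, a, b, c], S2_class [e, a, b, c, d]}" (is "_ = ?N")
proof (rule neighbors_word_class_graph)
  have S5: "[a, b, c, d, e] \<in> S5" "[b, c, d, e, a] \<in> S5" "[c, d, e, a, b] \<in> S5"
    "[d, e, a, b, c] \<in> S5" "[e, a, b, c, d] \<in> S5"
    using assms by (auto simp: S5_iff)
  then show "D5_class [a, b, c, d, e] \<in> D5_class ` S5 \<union> S2_class ` S5"
    "?N \<subseteq> D5_class ` S5 \<union> S2_class ` S5"
    by blast+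
  fix B
  assume B: "base_cobase R10 B" "card B = 5"
  have "realize ` ?N = {bull [a, b, c, d, e], bull [b, c, d, e, a], bull [c, d, e, a, b],
    bull [d, e, a, b, c], bull [e, a, b, c, d]}"
    using S5 by (simp only: image_insert image_empty realize_S2_class)
  with cycle_neighbours[OF assms B] card_sym_diff_cycle[OF assms] S5(1)
  show "card (sym_diff (realize (D5_class [a, b, c, d, e])) B) = 2 \<longleftrightarrow> B \<in> realize ` ?N"
    by (metis realize_D5_class)
qed

lemma digraph_iso_base_cobase_graph:
  "digraph_iso (with_proj (base_cobase_graph R10)) (with_proj word_class_graph)"
proof (rule digraph_iso_with_projI)
  show "pair_wf_digraph (base_cobase_graph R10)"
    using pair_graph_base_cobase_graph[OF matroid_R10]
    by (auto simp: base_cobase_graph_def pair_wf_digraph_def)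
  show "pair_wf_digraph word_class_graph"
    by (auto simp: word_class_graph_def pair_wf_digraph_def)
  show "bij_betw realize (pverts word_class_graph) (pverts (base_cobase_graph R10))"
    using inj_on_realize realize_image by (simp add: bij_betw_def word_class_graph_def base_cobase_graph_def)
  show "(realize u, realize v) \<in> parcs (base_cobase_graph R10) \<longleftrightarrow> (u, v) \<in> parcs word_class_graph"
    if "u \<in> pverts word_class_graph" "v \<in> pverts word_class_graph" for u v
    using that realize_image by (auto simp: word_class_graph_def base_cobase_graph_def)
qed

theorem theorem5p4:
  shows "\<exists>H :: (5 list set + 5 list set) pair_pre_digraph.
    pair_graph H \<and>
    pverts H = (S5 // D5_rel) <+> (S5 // S2_rel) \<and>
    (\<forall>a b c d e. [a, b, c, d, e] \<in> S5 \<longrightarrow>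
      neighbors H (S2_class [a, b, c, d, e]) =
        {D5_class [a, b, c, d, e], S2_class [c, b, a, d, e], S2_class [a, c, b, d, e],
         S2_class [a, b, d, c, e], S2_class [a, b, e, d, c]}) \<and>
    (\<forall>a b c d e. [a, b, c, d, e] \<in> S5 \<longrightarrow>
      neighbors H (D5_class [a, b, c, d, e]) =
        {S2_class [a, b, c, d, e], S2_class [b, c, d, e, a], S2_class [c, d, e, a, b],
         S2_class [d, e, a, b, c], S2_class [e, a, b, c, d]}) \<and>
    digraph_iso (with_proj (base_cobase_graph R10)) (with_proj H)"
  using pair_graph_word_class_graph pverts_word_class_graph neighbors_S2_class neighbors_D5_class
    digraph_iso_base_cobase_graph
  by (intro exI[of _ word_class_graph] conjI allI impI) (simp_all only: S5_iff)

end
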